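(* Let $B$ be a collection of patterns. If $B$ is inversion monotone, then so are the four collections $$B^{\ell} = \{p : p \smallsetminus p_1 \in B\},\quad B^r = \{p : p \smallsetminus p_{|p|} \in B\},\quad B^u = \{p : p \smallsetminus |p| \in B\},\quad B^d = \{p : p \smallsetminus 1 \in B\}.$$
   Context: A pattern is a nonempty permutation; $|p|$ is the length of $p$. A permutation $\pi$ contains a pattern $p$ if $\pi$ (in one-line notation) has a subsequence order-isomorphic to $p$; otherwise it avoids $p$. For a permutation $p$ and a value $e\in\{1,\dots,|p|\}$, $p\smallsetminus e$ denotes the permutation order-isomorphic to the sequence obtained by removing the entry with value $e$ from the one-line notation of $p$. Thus $B^\ell, B^r, B^u, B^d$ consist of all patterns obtained from patterns in $B$ by inserting, in all possible ways, a new first entry, a new last entry, a new largest entry, or a new smallest entry, respectively. An inversion of $\pi$ is a pair $i<j$ with $\pi_i>\pi_j$. $\mathrm{av}_n^k(B)$ is the number of permutations in $S_n$ with exactly $k$ inversions that avoid every pattern in $B$. $B$ is inversion monotone if $\mathrm{av}_n^k(B)\le \mathrm{av}_{n+1}^k(B)$ for all integers $n,k\ge 0$ (where $S_0$ consists of the empty permutation). *)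

theory Defs
  imports "HOL-Combinatorics.Multiset_Permutations" "HOL-Library.Sublist"
begin

text \<open>
  A permutation of length \<open>n\<close> is given by its one-line notation: a list of length \<open>n\<close> over
  the values \<open>1, \<dots>, n\<close>, i.e. an element of \<^term>\<open>permutations_of_set {1..n}\<close>. Positions in a
  list are counted from 0, values from 1.
\<close>

definition perms :: "nat \<Rightarrow> nat list set" where
  "perms n = permutations_of_set {1..n}"

definition patterns :: "nat list set" where
  "patterns = (\<Union>n\<in>{1..}. perms n)"

definition order_isomorphic :: "nat list \<Rightarrow> nat list \<Rightarrow> bool" where
  "order_isomorphic xs ys \<longleftrightarrow> length xs = length ys \<and>
     (\<forall>i < length xs. \<forall>j < length xs. xs ! i < xs ! j \<longleftrightarrow> ys ! i < ys ! j)"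

definition contains :: "nat list \<Rightarrow> nat list \<Rightarrow> bool" where
  "contains \<pi> p \<longleftrightarrow> (\<exists>xs. subseq xs \<pi> \<and> order_isomorphic xs p)"

text \<open>
  The permutation order-isomorphic to a list of distinct numbers: each entry is replaced by its
  rank. See \<open>standardize_eqI\<close>, \<open>standardize_perms\<close> and \<open>order_isomorphic_standardize\<close> below.
\<close>

definition standardize :: "nat list \<Rightarrow> nat list" where
  "standardize xs = map (\<lambda>x. card {y \<in> set xs. y \<le> x}) xs"

definition del_value :: "nat list \<Rightarrow> nat \<Rightarrow> nat list"  (infixl \<open>\<smallsetminus>\<close> 65) where
  "p \<smallsetminus> e = standardize (remove1 e p)"

definition inversions :: "nat list \<Rightarrow> (nat \<times> nat) set" where
  "inversions \<pi> = {(i, j). i < j \<and> j < length \<pi> \<and> \<pi> ! i > \<pi> ! j}"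

definition av :: "nat list set \<Rightarrow> nat \<Rightarrow> nat \<Rightarrow> nat" where
  "av B n k = card {\<pi> \<in> perms n. card (inversions \<pi>) = k \<and> (\<forall>p\<in>B. \<not> contains \<pi> p)}"

definition inversion_monotone :: "nat list set \<Rightarrow> bool" where
  "inversion_monotone B \<longleftrightarrow> (\<forall>n k. av B n k \<le> av B (Suc n) k)"

lemma rank_less_iff:
  assumes "finite A" "x \<in> A" "(z::nat) \<in> A"
  shows "card {y \<in> A. y \<le> x} < card {y \<in> A. y \<le> z} \<longleftrightarrow> x < z"
proof
  assume "x < z"
  then have "z \<in> {y \<in> A. y \<le> z} - {y \<in> A. y \<le> x}" "{y \<in> A. y \<le> x} \<subseteq> {y \<in> A. y \<le> z}"
    using assms by auto
  then have "{y \<in> A. y \<le> x} \<subset> {y \<in> A. y \<le> z}" by blast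
  then show "card {y \<in> A. y \<le> x} < card {y \<in> A. y \<le> z}"
    using assms(1) by (intro psubset_card_mono) auto
next
  assume *: "card {y \<in> A. y \<le> x} < card {y \<in> A. y \<le> z}"
  show "x < z"
  proof (rule ccontr)
    assume "\<not> x < z"
    then have "card {y \<in> A. y \<le> z} \<le> card {y \<in> A. y \<le> x}"
      using assms(1) by (intro card_mono) auto
    with * show False by simp
  qed
qed

lemma order_isomorphic_standardize: "order_isomorphic (standardize xs) xs"
  using rank_less_iff[of "set xs"] by (simp add: order_isomorphic_def standardize_def)

lemma standardize_perms:
  assumes "distinct xs"
  shows "standardize xs \<in> perms (length xs)"
proof -
  let ?r = "\<lambda>x. card {y \<in> set xs. y \<le> x}"
  have inj: "inj_on ?r (set xs)"
  proof (rule inj_onI)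
    fix x z assume xz: "x \<in> set xs" "z \<in> set xs" "?r x = ?r z"
    then have "\<not> x < z" "\<not> z < x"
      using rank_less_iff[of "set xs" x z] rank_less_iff[of "set xs" z x] by simp_all
    then show "x = z" by simp
  qed
  have "?r ` set xs \<subseteq> {1..length xs}"
  proof (rule image_subsetI)
    fix x assume x: "x \<in> set xs"
    have "card {x} \<le> ?r x" using x by (intro card_mono) auto
    moreover have "?r x \<le> card (set xs)" by (intro card_mono) auto
    ultimately show "?r x \<in> {1..length xs}" using card_length[of xs] by simp
  qed
  moreover have "card (?r ` set xs) = length xs"
    using inj assms by (simp add: card_image distinct_card)
  ultimately have "?r ` set xs = {1..length xs}"
    by (intro card_subset_eq) auto
  then show ?thesis
    using inj assms by (auto simp: perms_def permutations_of_set_def standardize_def distinct_map)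
qed

lemma standardize_eqI:
  assumes p: "p \<in> perms n" and iso: "order_isomorphic p xs"
  shows "p = standardize xs"
proof (rule nth_equalityI)
  have len: "length p = length xs" using iso by (simp add: order_isomorphic_def)
  show "length p = length (standardize xs)" by (simp add: standardize_def len)
  fix i assume i: "i < length p"
  have set_p: "set p = {1..n}" and dist: "distinct p"
    using p by (auto simp: perms_def permutations_of_set_def)
  have less: "p ! j < p ! k \<longleftrightarrow> xs ! j < xs ! k" if "j < length p" "k < length p" for j k
    using iso that by (simp add: order_isomorphic_def)
  have le: "p ! j \<le> p ! k \<longleftrightarrow> xs ! j \<le> xs ! k" if "j < length p" "k < length p" for j k
    using less[of k j] that by (metis not_less)
  let ?J = "{j. j < length p \<and> p ! j \<le> p ! i}"
  have eq: "xs ! j = xs ! k \<longleftrightarrow> p ! j = p ! k" if "j < length p" "k < length p" for j k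
    using le[of j k] le[of k j] that by (simp add: order_eq_iff)
  have "{y \<in> set xs. y \<le> xs ! i} = (\<lambda>j. xs ! j) ` ?J"
    using i len le by (auto simp: in_set_conv_nth)
  moreover have "inj_on (\<lambda>j. xs ! j) ?J"
    using eq dist by (auto simp: inj_on_def nth_eq_iff_index_eq)
  ultimately have "card {y \<in> set xs. y \<le> xs ! i} = card ?J"
    by (simp add: card_image)
  moreover have "{y \<in> set p. y \<le> p ! i} = (\<lambda>j. p ! j) ` ?J"
    by (auto simp: in_set_conv_nth)
  moreover have "inj_on (\<lambda>j. p ! j) ?J"
    using dist by (auto simp: inj_on_def nth_eq_iff_index_eq)
  ultimately have "card {y \<in> set xs. y \<le> xs ! i} = card {y \<in> set p. y \<le> p ! i}"
    by (simp add: card_image)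
  moreover have "{y \<in> set p. y \<le> p ! i} = {1..p ! i}"
    using nth_mem[OF i] unfolding set_p by auto
  ultimately show "p ! i = standardize xs ! i"
    using i len by (simp add: standardize_def)
qed

end

theory Submission
  imports Defs
begin

text \<open>
  Deleting the first, last, largest or smallest entry of a permutation of length \<open>n + 1\<close>, and
  recording the number \<open>j \<le> n\<close> of inversions lost, is a bijection onto pairs of a permutation of
  length \<open>n\<close> and a number in \<open>{0, \<dots>, n}\<close>. A permutation avoids the extended
  collection \<open>C\<close> iff its deletion avoids \<open>B\<close>, so \<open>av C (n + 1) k\<close> is the
  sum of \<open>av B n (k - j)\<close> over \<open>j \<le> min n k\<close>, and this sum grows with \<open>n\<close>
  termwise and in its number of terms.
\<close>

section \<open>Order isomorphism and standardization\<close>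

lemma order_isomorphic_sym: "order_isomorphic xs ys \<Longrightarrow> order_isomorphic ys xs"
  by (simp add: order_isomorphic_def)

lemma order_isomorphic_trans:
  "order_isomorphic xs ys \<Longrightarrow> order_isomorphic ys zs \<Longrightarrow> order_isomorphic xs zs"
  by (simp add: order_isomorphic_def)

lemma order_isomorphic_map:
  assumes "strict_mono_on (set xs) f"
  shows "order_isomorphic (map f xs) xs"
  using assms by (auto simp: order_isomorphic_def strict_mono_on_less)

text \<open>\<open>standardize xs\<close> is a permutation order-isomorphic to \<open>xs\<close>,
  hence to \<open>ys\<close>, and only one permutation is order-isomorphic to
  \<open>ys\<close>.\<close>

lemma standardize_cong:
  assumes "distinct xs" "order_isomorphic xs ys"
  shows "standardize xs = standardize ys"
  using standardize_eqI[OF standardize_perms[OF assms(1)]]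
    order_isomorphic_trans[OF order_isomorphic_standardize assms(2)] by blast

lemma strict_mono_on_rank:
  "finite A \<Longrightarrow> strict_mono_on A (\<lambda>x::nat. card {y \<in> A. y \<le> x})"
  by (simp add: strict_mono_on_def rank_less_iff)

text \<open>Without repetitions a subsequence is determined by its set of values, so subsequences
  can be handled as filters.\<close>

lemma subseq_filter_distinct:
  "subseq xs ys \<Longrightarrow> distinct ys \<Longrightarrow> xs = filter (\<lambda>x. x \<in> set xs) ys"
  by (auto simp: subseq_conv_nths filter_in_nths)

lemma subseq_distinct: "subseq xs ys \<Longrightarrow> distinct ys \<Longrightarrow> distinct xs"
  by (auto simp: subseq_conv_nths distinct_nthsI)

text \<open>The witness takes from \<open>ys\<close> the positions that \<open>zs\<close> occupies
  in \<open>xs\<close>. Both full lists have the same list of ranks, and ranks increase strictly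
  with the values.\<close>

lemma order_isomorphic_subseq:
  assumes "order_isomorphic xs ys" "subseq zs xs" "distinct xs" "distinct ys"
  shows "\<exists>ws. subseq ws ys \<and> order_isomorphic zs ws"
proof -
  obtain N where N: "zs = nths xs N"
    using assms(2) by (auto simp: subseq_conv_nths)
  define g where "g = (\<lambda>y. card {z \<in> set ys. z \<le> y})"
  define f where "f = (\<lambda>x. card {z \<in> set xs. z \<le> x})"
  have "map f xs = map g ys"
    using standardize_cong[OF assms(3,1)] by (simp add: standardize_def f_def g_def)
  then have "map f (nths xs N) = map g (nths ys N)"
    by (simp flip: nths_map)
  moreover have "strict_mono_on (set (nths xs N)) f" "strict_mono_on (set (nths ys N)) g"
    using strict_mono_on_rank[of "set xs"] strict_mono_on_rank[of "set ys"]
    by (auto simp: f_def g_def intro: monotone_on_subset dest: set_nths_subset[THEN subsetD])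
  ultimately have "order_isomorphic (nths xs N) (nths ys N)"
    by (metis order_isomorphic_map order_isomorphic_sym order_isomorphic_trans)
  then show ?thesis
    unfolding N by (auto simp: subseq_conv_nths)
qed

lemma contains_cong:
  assumes "order_isomorphic xs ys" "distinct xs" "distinct ys"
  shows "contains xs p \<longleftrightarrow> contains ys p"
  unfolding contains_def
  using order_isomorphic_subseq assms order_isomorphic_sym order_isomorphic_trans by meson

lemma contains_standardize: "distinct xs \<Longrightarrow> contains (standardize xs) p \<longleftrightarrow> contains xs p"
  using contains_cong[OF order_isomorphic_standardize] standardize_perms
  by (auto simp: perms_def permutations_of_set_def)

text \<open>Equal value sets give both lists one and the same rank function, which is injective and
  can be cancelled.\<close>

lemma standardize_inj:
  assumes "set xs = set ys" "standardize xs = standardize ys"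
  shows "xs = ys"
proof -
  have "inj_on (\<lambda>x. card {y \<in> set ys. y \<le> x}) (set ys)"
    using strict_mono_on_rank[of "set ys"] by (simp add: strict_mono_on_imp_inj_on)
  then show ?thesis
    using assms by (auto simp: standardize_def intro: map_inj_on)
qed

section \<open>Deleting one value from a permutation\<close>

lemma remove1_eq_filter: "distinct xs \<Longrightarrow> remove1 e xs = filter (\<lambda>x. x \<noteq> e) xs"
  by (auto simp: distinct_remove1_removeAll removeAll_filter_not_eq intro: filter_cong)

lemma permsD:
  assumes "p \<in> perms n"
  shows "set p = {1..n}" "distinct p" "length p = n"
proof -
  show *: "set p = {1..n}" "distinct p"
    using assms by (auto simp: perms_def permutations_of_set_def)
  show "length p = n"
    using distinct_card[OF *(2)] * by simp
qed

lemma finite_perms: "finite (perms n)"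
  by (simp add: perms_def)

lemma del_value_perms:
  assumes "p \<in> perms (Suc n)" "e \<in> set p"
  shows "p \<smallsetminus> e \<in> perms n"
  using standardize_perms[of "remove1 e p"] permsD[OF assms(1)] assms(2)
  by (simp add: del_value_def length_remove1)

text \<open>Both lists keep the same values after the deletion, so standardization loses no
  information.\<close>

lemma del_value_inj:
  assumes "p \<in> perms n" "q \<in> perms n" "p \<smallsetminus> e = q \<smallsetminus> e"
  shows "remove1 e p = remove1 e q"
  using assms standardize_inj[of "remove1 e p" "remove1 e q"] permsD
  by (auto simp: del_value_def)

section \<open>Counting inversions\<close>

lemma finite_inversions: "finite (inversions xs)"
  by (rule finite_subset[of _ "{..<length xs} \<times> {..<length xs}"]) (auto simp: inversions_def)

lemma inversions_cong: "order_isomorphic xs ys \<Longrightarrow> inversions xs = inversions ys"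
  by (auto simp: inversions_def order_isomorphic_def)

text \<open>Inversions split into those that use position 0 and shifted copies of those of
  \<open>xs\<close>.\<close>

lemma card_inversions_Cons:
  "card (inversions (x # xs)) = length (filter (\<lambda>y. y < x) xs) + card (inversions xs)"
proof -
  let ?J = "{j. j < length xs \<and> xs ! j < x}"
  have "inversions (x # xs) = (\<lambda>j. (0, Suc j)) ` ?J \<union> map_prod Suc Suc ` inversions xs"
    (is "_ = ?A \<union> ?B")
  proof (intro subset_antisym subsetI)
    fix z assume "z \<in> inversions (x # xs)"
    then obtain i j where z: "z = (i, j)" and ij: "i < j" "j < Suc (length xs)"
        "(x # xs) ! j < (x # xs) ! i"
      by (auto simp: inversions_def)
    obtain j' where "j = Suc j'" using ij by (cases j) auto
    then show "z \<in> ?A \<union> ?B"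
      using z ij by (cases i) (auto simp: inversions_def)
  qed (auto simp: inversions_def)
  moreover have "card ?A = length (filter (\<lambda>y. y < x) xs)"
    by (simp add: card_image inj_on_def length_filter_conv_card)
  moreover have "card ?B = card (inversions xs)"
    by (intro card_image) (auto simp: inj_on_def)
  moreover have "finite ?A" "finite ?B" "?A \<inter> ?B = {}"
    by (auto simp: finite_inversions)
  ultimately show ?thesis by (simp add: card_Un_disjoint)
qed

text \<open>The entry \<open>e\<close> is inverted exactly with the larger entries before it and the
  smaller ones after it; all other pairs are unaffected.\<close>

lemma card_inversions_insert:
  "card (inversions (as @ e # bs)) = card (inversions (as @ bs)) +
     (length (filter (\<lambda>a. a > e) as) + length (filter (\<lambda>b. b < e) bs))"
  by (induction as) (auto simp: card_inversions_Cons)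

lemma card_inversions_del_value: "card (inversions (p \<smallsetminus> e)) = card (inversions (remove1 e p))"
  unfolding del_value_def by (simp add: inversions_cong[OF order_isomorphic_standardize])

text \<open>Deletion destroys only the inversions through \<open>e\<close>, and \<open>e\<close>
  forms a pair with each of just \<open>n\<close> other entries.\<close>

lemma card_inversions_del_value_bounds:
  assumes "p \<in> perms (Suc n)" "e \<in> set p"
  shows "card (inversions (p \<smallsetminus> e)) \<le> card (inversions p)"
    and "card (inversions p) \<le> card (inversions (p \<smallsetminus> e)) + n"
proof -
  obtain as bs where p: "p = as @ e # bs" "e \<notin> set as"
    using split_list_first[OF assms(2)] by auto
  have "length as + length bs = n"
    using permsD(3)[OF assms(1)] p by simp
  then have "length (filter (\<lambda>a. a > e) as) + length (filter (\<lambda>b. b < e) bs) \<le> n"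
    using length_filter_le[of "\<lambda>a. a > e" as] length_filter_le[of "\<lambda>b. b < e" bs] by linarith
  then show "card (inversions (p \<smallsetminus> e)) \<le> card (inversions p)"
      "card (inversions p) \<le> card (inversions (p \<smallsetminus> e)) + n"
    using p card_inversions_insert[of as e bs]
    by (simp_all add: card_inversions_del_value remove1_append)
qed

section \<open>Deleting a distinguished entry\<close>

text \<open>Common interface of the four choices of an entry. \<open>sel_map\<close> makes the
  choice compatible with standardization, \<open>sel_filter\<close> with passing to a subsequence
  that keeps the chosen entry, and \<open>reconstruct\<close> says that the deletion and the
  inversion count together recover the permutation.\<close>

locale selector =
  fixes sel :: "nat list \<Rightarrow> nat"
  assumes sel_in: "xs \<noteq> [] \<Longrightarrow> sel xs \<in> set xs"
    and sel_map: "xs \<noteq> [] \<Longrightarrow> strict_mono_on (set xs) f \<Longrightarrow> sel (map f xs) = f (sel xs)"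
    and sel_filter: "xs \<noteq> [] \<Longrightarrow> P (sel xs) \<Longrightarrow> sel (filter P xs) = sel xs"
    and reconstruct: "p \<in> perms (Suc n) \<Longrightarrow> q \<in> perms (Suc n) \<Longrightarrow> p \<smallsetminus> sel p = q \<smallsetminus> sel q \<Longrightarrow>
          card (inversions p) = card (inversions q) \<Longrightarrow> p = q"
begin

definition extension :: "nat list set \<Rightarrow> nat list set" where
  "extension B = {p \<in> patterns. p \<smallsetminus> sel p \<in> B}"

text \<open>By \<open>sel_map\<close>, the entry selected after ranking is the rank of the one
  selected before. The remaining ranks, though taken in the larger set, are still order-isomorphic
  to the remaining entries.\<close>

lemma standardize_del_value_sel:
  assumes "distinct xs" "xs \<noteq> []"
  shows "standardize xs \<smallsetminus> sel (standardize xs) = standardize (remove1 (sel xs) xs)"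
proof -
  define r where "r = (\<lambda>x. card {y \<in> set xs. y \<le> x})"
  have st: "standardize xs = map r xs" by (simp add: standardize_def r_def)
  have mono: "strict_mono_on (set xs) r"
    unfolding r_def by (rule strict_mono_on_rank) simp
  have inj: "inj_on r (set xs)"
    using mono by (rule strict_mono_on_imp_inj_on)
  have dist: "distinct (map r xs)"
    using assms inj by (simp add: distinct_map)
  have "remove1 (r (sel xs)) (map r xs) = map r (remove1 (sel xs) xs)"
    using map_removeAll_inj_on[of r "sel xs" xs] assms dist inj sel_in[of xs]
    by (simp add: distinct_remove1_removeAll insert_absorb)
  moreover have "strict_mono_on (set (remove1 (sel xs) xs)) r"
    using mono by (rule monotone_on_subset) (rule set_remove1_subset)
  moreover have "distinct (map r (remove1 (sel xs) xs))"
    using calculation(1) dist by (metis distinct_remove1)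
  ultimately show ?thesis
    using sel_map[OF assms(2) mono] standardize_cong[OF _ order_isomorphic_map]
    by (simp add: st del_value_def)
qed

text \<open>An occurrence of an extended pattern yields one of its deletion by dropping the selected
  entry; conversely, \<open>sel xs\<close> is adjoined to an occurrence in the deletion.\<close>

lemma contains_extension_iff:
  assumes "B \<subseteq> patterns" "distinct xs" "xs \<noteq> []"
  shows "(\<exists>p\<in>extension B. contains xs p) \<longleftrightarrow> (\<exists>q\<in>B. contains (xs \<smallsetminus> sel xs) q)"
proof -
  let ?e = "sel xs"
  have del: "contains (xs \<smallsetminus> ?e) q \<longleftrightarrow> contains (remove1 ?e xs) q" for q
    unfolding del_value_def using assms by (intro contains_standardize) simp
  show ?thesis
  proof
    assume "\<exists>p\<in>extension B. contains xs p"
    then obtain p zs where p: "p \<in> patterns" "p \<smallsetminus> sel p \<in> B"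
      and zs: "subseq zs xs" "order_isomorphic zs p"
      by (auto simp: extension_def contains_def)
    from p(1) obtain m where "m \<ge> 1" and m: "p \<in> perms m" by (auto simp: patterns_def)
    then have "p \<noteq> []" using permsD(3) by fastforce
    then have ne: "zs \<noteq> []" using zs(2) by (auto simp: order_isomorphic_def)
    have dist: "distinct zs" using subseq_distinct assms zs(1) by blast
    have "p = standardize zs"
      using standardize_eqI m zs(2) order_isomorphic_sym by blast
    then have q: "p \<smallsetminus> sel p = standardize (remove1 (sel zs) zs)"
      using standardize_del_value_sel dist ne by simp
    \<comment> \<open>If the occurrence uses \<open>?e\<close>, then \<open>?e\<close> is also its
      own selected entry and both sides drop the same value. Otherwise all of \<open>zs\<close>
      survives in \<open>remove1 ?e xs\<close>, and dropping an entry of \<open>zs\<close> only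
      shortens it.\<close>
    have "subseq (remove1 (sel zs) zs) (remove1 ?e xs)"
    proof (cases "?e \<in> set zs")
      case True
      have "zs = filter (\<lambda>x. x \<in> set zs) xs"
        using zs(1) assms(2) by (rule subseq_filter_distinct)
      then have "sel zs = ?e" using sel_filter[OF assms(3), of "\<lambda>x. x \<in> set zs"] True by metis
      then show ?thesis
        using zs(1) dist assms(2) by (simp add: remove1_eq_filter)
    next
      case False
      then have "filter (\<lambda>x. x \<noteq> ?e) zs = zs" by (auto simp: filter_id_conv)
      then have "subseq zs (remove1 ?e xs)"
        using subseq_filter[OF zs(1), of "\<lambda>x. x \<noteq> ?e"] assms(2)
        by (simp add: remove1_eq_filter)
      moreover have "subseq (remove1 (sel zs) zs) zs"
        using dist by (simp add: remove1_eq_filter)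
      ultimately show ?thesis by (rule subseq_order.trans[rotated])
    qed
    then have "contains (remove1 ?e xs) (p \<smallsetminus> sel p)"
      unfolding q contains_def
      using order_isomorphic_sym order_isomorphic_standardize by blast
    then show "\<exists>q\<in>B. contains (xs \<smallsetminus> sel xs) q" using p del by blast
  next
    assume "\<exists>q\<in>B. contains (xs \<smallsetminus> sel xs) q"
    then obtain q zs where q: "q \<in> B" and zs: "subseq zs (remove1 ?e xs)" "order_isomorphic zs q"
      unfolding del by (auto simp: contains_def)
    have rem: "remove1 ?e xs = filter (\<lambda>x. x \<noteq> ?e) xs"
      using assms by (simp add: remove1_eq_filter)
    have zs_eq: "zs = filter (\<lambda>x. x \<in> set zs) (remove1 ?e xs)"
      by (rule subseq_filter_distinct[OF zs(1)]) (simp add: assms(2))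
    \<comment> \<open>The occurrence \<open>zs\<close> with \<open>?e\<close> put back at its place
      in \<open>xs\<close>; its standardization is the extended pattern sought.\<close>
    define ys where "ys = filter (\<lambda>x. x = ?e \<or> x \<in> set zs) xs"
    have sel_ys: "sel ys = ?e"
      unfolding ys_def using assms by (intro sel_filter) auto
    have ys: "distinct ys" "ys \<noteq> []"
      using assms sel_in[of xs] by (auto simp: ys_def filter_empty_conv)
    have "remove1 ?e ys = filter (\<lambda>x. x \<noteq> ?e) ys"
      using ys by (simp add: remove1_eq_filter)
    also have "\<dots> = filter (\<lambda>x. x \<in> set zs) (remove1 ?e xs)"
      by (auto simp: ys_def rem intro: filter_cong)
    also have "\<dots> = zs"
      by (rule zs_eq[symmetric])
    finally have "standardize ys \<smallsetminus> sel (standardize ys) = standardize zs"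
      using standardize_del_value_sel[OF ys] sel_ys by simp
    moreover have "q = standardize zs"
      using q assms(1) standardize_eqI zs(2) order_isomorphic_sym by (fastforce simp: patterns_def)
    moreover have "standardize ys \<in> patterns"
      using standardize_perms[OF ys(1)] ys(2) by (cases ys) (auto simp: patterns_def)
    ultimately have "standardize ys \<in> extension B"
      using q by (simp add: extension_def)
    moreover have "contains xs (standardize ys)"
      unfolding contains_def ys_def
      using order_isomorphic_sym order_isomorphic_standardize subseq_filter_left by blast
    ultimately show "\<exists>p\<in>extension B. contains xs p" by blast
  qed
qed

text \<open>Injectivity is \<open>reconstruct\<close>, as the inversions lost and those left add up
  to the total. Surjectivity follows by counting: (n+1)! = (n+1) n!.\<close>

lemma bij_betw_deletion:
  "bij_betw (\<lambda>p. (card (inversions p) - card (inversions (p \<smallsetminus> sel p)), p \<smallsetminus> sel p))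
     (perms (Suc n)) ({..n} \<times> perms n)"
  (is "bij_betw ?\<Phi> _ _")
proof -
  have sel: "sel p \<in> set p" if "p \<in> perms (Suc n)" for p
    using that permsD(3) by (intro sel_in) fastforce
  have inj: "inj_on ?\<Phi> (perms (Suc n))"
  proof (rule inj_onI)
    fix p q assume *: "p \<in> perms (Suc n)" "q \<in> perms (Suc n)" "?\<Phi> p = ?\<Phi> q"
    have del: "p \<smallsetminus> sel p = q \<smallsetminus> sel q"
      and lost: "card (inversions p) - card (inversions (p \<smallsetminus> sel p)) =
        card (inversions q) - card (inversions (q \<smallsetminus> sel q))"
      using Pair_inject[OF *(3)] by blast+
    have "card (inversions p) = card (inversions q)"
      using lost card_inversions_del_value_bounds(1)[OF *(1) sel[OF *(1)]]
        card_inversions_del_value_bounds(1)[OF *(2) sel[OF *(2)]]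
      unfolding del by linarith
    with *(1,2) del show "p = q" by (rule reconstruct)
  qed
  have sub: "?\<Phi> ` perms (Suc n) \<subseteq> {..n} \<times> perms n"
  proof (rule image_subsetI)
    fix p assume p: "p \<in> perms (Suc n)"
    then show "?\<Phi> p \<in> {..n} \<times> perms n"
      using card_inversions_del_value_bounds(2)[OF p sel] del_value_perms[OF p sel] by simp
  qed
  have "card (?\<Phi> ` perms (Suc n)) = card ({..n} \<times> perms n)"
    using card_image[OF inj] by (simp add: perms_def card_permutations_of_set card_cartesian_product)
  then have "?\<Phi> ` perms (Suc n) = {..n} \<times> perms n"
    using sub by (intro card_subset_eq) (auto simp: finite_perms)
  with inj show ?thesis by (simp add: bij_betw_def)
qed

text \<open>Avoidance of \<open>extension B\<close> depends only on the deletion, so the bijection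
  restricts to avoiders, sorted by the number \<open>j\<close> of inversions lost. The bound
  \<open>j \<le> k\<close> keeps the truncated difference \<open>k - j\<close> honest.\<close>

lemma av_extension_Suc:
  assumes "B \<subseteq> patterns"
  shows "av (extension B) (Suc n) k = (\<Sum>j\<in>{j. j \<le> n \<and> j \<le> k}. av B n (k - j))"
proof -
  let ?\<Phi> = "\<lambda>p. (card (inversions p) - card (inversions (p \<smallsetminus> sel p)), p \<smallsetminus> sel p)"
  let ?L = "{p \<in> perms (Suc n). card (inversions p) = k \<and> (\<forall>q\<in>extension B. \<not> contains p q)}"
  let ?R = "SIGMA j:{j. j \<le> n \<and> j \<le> k}.
     {p \<in> perms n. card (inversions p) = k - j \<and> (\<forall>q\<in>B. \<not> contains p q)}"
  have bij: "bij_betw ?\<Phi> (perms (Suc n)) ({..n} \<times> perms n)"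
    by (rule bij_betw_deletion)
  have iff: "p \<in> ?L \<longleftrightarrow> ?\<Phi> p \<in> ?R" if p: "p \<in> perms (Suc n)" for p
  proof -
    have "p \<noteq> []" "distinct p" using permsD[OF p] by auto
    then have "(\<forall>q\<in>extension B. \<not> contains p q) \<longleftrightarrow> (\<forall>q\<in>B. \<not> contains (p \<smallsetminus> sel p) q)"
      using contains_extension_iff[OF assms] by blast
    moreover have "?\<Phi> p \<in> {..n} \<times> perms n"
      using bij p by (rule bij_betwE[rule_format])
    moreover have "card (inversions (p \<smallsetminus> sel p)) \<le> card (inversions p)"
      using card_inversions_del_value_bounds(1)[OF p sel_in] \<open>p \<noteq> []\<close> by blast
    ultimately show ?thesis using p by auto
  qed
  have img: "?\<Phi> ` ?L = ?R"
  proof (intro subset_antisym subsetI)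
    fix z assume "z \<in> ?\<Phi> ` ?L"
    then show "z \<in> ?R" using iff by blast
  next
    fix z assume z: "z \<in> ?R"
    then have "z \<in> ?\<Phi> ` perms (Suc n)"
      using bij_betw_imp_surj_on[OF bij] by auto
    then show "z \<in> ?\<Phi> ` ?L" using iff z by blast
  qed
  have "inj_on ?\<Phi> ?L"
    using bij_betw_imp_inj_on[OF bij] by (rule inj_on_subset) auto
  then have "card ?L = card (?\<Phi> ` ?L)" by (rule card_image[symmetric])
  also have "\<dots> = card ?R" by (simp only: img)
  finally show ?thesis
    by (simp add: av_def finite_perms)
qed

theorem inversion_monotone_extension:
  assumes "B \<subseteq> patterns" "inversion_monotone B"
  shows "inversion_monotone (extension B)"
  unfolding inversion_monotone_def
proof (intro allI)
  fix n k
  show "av (extension B) n k \<le> av (extension B) (Suc n) k"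
  proof (cases n)
    \<comment> \<open>The recursion covers positive lengths only. At length 1 its sum is the single
      term \<open>av B 0 k\<close>, which has to be compared with length 0 directly.\<close>
    case 0
    have perms0: "perms 0 = {[]}" by (simp add: perms_def)
    have "\<not> contains [] q" if "q \<in> B" for q
    proof -
      from that assms(1) obtain m where "m \<ge> 1" "q \<in> perms m" by (auto simp: patterns_def)
      then have "length q \<noteq> 0" using permsD(3) by simp
      then show ?thesis by (simp add: contains_def order_isomorphic_def)
    qed
    \<comment> \<open>Patterns are nonempty, so the empty permutation avoids all of
      \<open>B\<close>.\<close>
    then have "{p. p = [] \<and> card (inversions p) = k \<and> (\<forall>q\<in>extension B. \<not> contains p q)}
        \<subseteq> {p. p = [] \<and> card (inversions p) = k \<and> (\<forall>q\<in>B. \<not> contains p q)}"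
      by auto
    then have "av (extension B) 0 k \<le> av B 0 k"
      unfolding av_def perms0 by (intro card_mono) auto
    moreover have "{j. j \<le> 0 \<and> j \<le> k} = {0}" by auto
    ultimately show ?thesis
      using 0 av_extension_Suc[OF assms(1), of 0 k] by simp
  next
    case (Suc m)
    \<comment> \<open>First the terms grow, by monotonicity of \<open>B\<close>; then the index set
      grows, possibly by \<open>j = Suc m\<close>.\<close>
    have "(\<Sum>j\<in>{j. j \<le> m \<and> j \<le> k}. av B m (k - j)) \<le>
          (\<Sum>j\<in>{j. j \<le> m \<and> j \<le> k}. av B (Suc m) (k - j))"
      using assms(2) by (intro sum_mono) (simp add: inversion_monotone_def)
    also have "\<dots> \<le> (\<Sum>j\<in>{j. j \<le> Suc m \<and> j \<le> k}. av B (Suc m) (k - j))"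
      by (intro sum_mono2) auto
    finally show ?thesis
      by (simp add: Suc av_extension_Suc[OF assms(1)])
  qed
qed

end

section \<open>The four distinguished entries\<close>

lemma length_filter_distinct: "distinct xs \<Longrightarrow> length (filter P xs) = card {x \<in> set xs. P x}"
  by (metis distinct_card distinct_filter set_filter)

lemma split_at_value:
  assumes "p \<in> perms n" "e \<in> set p"
  obtains as bs where "p = as @ e # bs" "remove1 e p = as @ bs" "e \<notin> set as" "e \<notin> set bs"
    "set as \<union> set bs = {1..n} - {e}"
proof -
  obtain as bs where p: "p = as @ e # bs" "e \<notin> set as"
    using split_list_first[OF assms(2)] by auto
  moreover have "e \<notin> set bs" using permsD(2)[OF assms(1)] p by auto
  moreover have "set as \<union> set bs = {1..n} - {e}"
    using permsD(1)[OF assms(1)] calculation by auto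
  ultimately show ?thesis using that by (simp add: remove1_append)
qed

text \<open>The inversions lost reveal the value of the first entry: it is inverted with every
  smaller value, \<open>hd r - 1\<close> in number.\<close>

interpretation first: selector hd
proof
  fix xs :: "nat list" and P assume "xs \<noteq> []" "P (hd xs)"
  then show "hd (filter P xs) = hd xs" by (cases xs) auto
next
  fix n p q
  assume pq: "p \<in> perms (Suc n)" "q \<in> perms (Suc n)" "p \<smallsetminus> hd p = q \<smallsetminus> hd q"
    and inv: "card (inversions p) = card (inversions q)"
  have lost: "\<exists>xs. r = hd r # xs \<and> 1 \<le> hd r \<and>
      card (inversions r) = card (inversions (r \<smallsetminus> hd r)) + (hd r - 1)"
    if r: "r \<in> perms (Suc n)" for r
  proof -
    obtain e xs where rx: "r = e # xs" using permsD(3)[OF r] by (cases r) auto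
    have xs: "distinct xs" "e \<notin> set xs" using permsD(2)[OF r] rx by auto
    have *: "insert e (set xs) = {1..Suc n}" using permsD(1)[OF r] rx by simp
    then have e: "e \<in> {1..Suc n}" by blast
    have mem: "x \<in> set xs \<longleftrightarrow> 1 \<le> x \<and> x \<le> Suc n \<and> x \<noteq> e" for x
      using * xs(2) by (metis atLeastAtMost_iff insert_iff)
    have "{x \<in> set xs. x < e} = {1..<e}"
      unfolding mem set_eq_iff mem_Collect_eq atLeastLessThan_iff using e by simp linarith
    with xs(1) have "length (filter (\<lambda>b. b < e) xs) = e - 1"
      by (simp add: length_filter_distinct)
    then show ?thesis
      using rx e by (simp add: card_inversions_Cons card_inversions_del_value)
  qed
  obtain xs ys where xs: "p = hd p # xs" "1 \<le> hd p" and ys: "q = hd q # ys" "1 \<le> hd q"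
    using lost pq by metis
  \<comment> \<open>The bound \<open>1 \<le> hd r\<close> in \<open>lost\<close> allows the
    truncated subtraction to be cancelled next.\<close>
  have "hd p - 1 = hd q - 1" using lost[OF pq(1)] lost[OF pq(2)] pq(3) inv by auto
  then have e: "hd p = hd q" using xs ys by simp
  then have "remove1 (hd p) p = remove1 (hd p) q" using del_value_inj pq by metis
  then have "xs = ys" using xs(1) ys(1) e by (metis remove1.simps(2))
  then show "p = q" using xs ys e by metis
qed (simp_all add: hd_map)

text \<open>Here the last entry is inverted with every larger value, so the loss
  \<open>Suc n - last r\<close> determines it.\<close>

interpretation final: selector last
proof
  fix xs :: "nat list" and P assume "xs \<noteq> []" "P (last xs)"
  then show "last (filter P xs) = last xs" by (cases xs rule: rev_cases) auto
next
  fix n p q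
  assume pq: "p \<in> perms (Suc n)" "q \<in> perms (Suc n)" "p \<smallsetminus> last p = q \<smallsetminus> last q"
    and inv: "card (inversions p) = card (inversions q)"
  have lost: "\<exists>xs. r = xs @ [last r] \<and> remove1 (last r) r = xs \<and> last r \<le> Suc n \<and>
      card (inversions r) = card (inversions (r \<smallsetminus> last r)) + (Suc n - last r)"
    if r: "r \<in> perms (Suc n)" for r
  proof -
    obtain e xs where rx: "r = xs @ [e]" using permsD(3)[OF r] by (cases r rule: rev_cases) auto
    have xs: "distinct xs" "e \<notin> set xs" using permsD(2)[OF r] rx by auto
    have *: "insert e (set xs) = {1..Suc n}" using permsD(1)[OF r] rx by simp
    then have e: "e \<in> {1..Suc n}" by blast
    have mem: "x \<in> set xs \<longleftrightarrow> 1 \<le> x \<and> x \<le> Suc n \<and> x \<noteq> e" for x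
      using * xs(2) by (metis atLeastAtMost_iff insert_iff)
    have "{x \<in> set xs. x > e} = {e<..Suc n}"
      unfolding mem set_eq_iff mem_Collect_eq greaterThanAtMost_iff using e by simp linarith
    with xs(1) have "length (filter (\<lambda>a. a > e) xs) = Suc n - e"
      by (simp add: length_filter_distinct)
    then show ?thesis
      using rx xs(2) e card_inversions_insert[of xs e "[]"]
      by (simp add: card_inversions_del_value remove1_append)
  qed
  obtain xs ys where xs: "p = xs @ [last p]" "remove1 (last p) p = xs" "last p \<le> Suc n"
    and ys: "q = ys @ [last q]" "remove1 (last q) q = ys" "last q \<le> Suc n"
    using lost pq by metis
  have "Suc n - last p = Suc n - last q" using lost[OF pq(1)] lost[OF pq(2)] pq(3) inv by auto
  then have e: "last p = last q" using xs ys by simp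
  then have "xs = ys" using del_value_inj[of p "Suc n" q "last p"] pq xs ys by metis
  then show "p = q" using xs ys e by metis
qed (simp_all add: last_map)

lemma Max_perms: "p \<in> perms (Suc n) \<Longrightarrow> Max (set p) = Suc n"
  by (simp add: permsD(1) Max_eq_iff)

lemma Min_perms: "p \<in> perms (Suc n) \<Longrightarrow> Min (set p) = 1"
  by (simp add: permsD(1) Min_eq_iff)

text \<open>The value is known to be \<open>Suc n\<close>; the loss now reveals its position, being
  the number of entries to its right.\<close>

interpretation largest: selector "\<lambda>xs. Max (set xs)"
proof
  fix xs :: "nat list" and f :: "nat \<Rightarrow> nat"
  assume *: "xs \<noteq> []" "strict_mono_on (set xs) f"
  then have "Max (f ` set xs) = f (Max (set xs))"
    by (intro Max_eqI) (auto intro: monotone_onD[OF strict_mono_on_imp_mono_on])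
  then show "Max (set (map f xs)) = f (Max (set xs))" by simp
next
  fix xs :: "nat list" and P assume "xs \<noteq> []" "P (Max (set xs))"
  then show "Max (set (filter P xs)) = Max (set xs)" by (intro Max_eqI) auto
next
  fix n p q
  assume pq: "p \<in> perms (Suc n)" "q \<in> perms (Suc n)"
    "p \<smallsetminus> Max (set p) = q \<smallsetminus> Max (set q)"
    and inv: "card (inversions p) = card (inversions q)"
  let ?e = "Suc n"
  have lost: "\<exists>as bs. r = as @ ?e # bs \<and> remove1 ?e r = as @ bs \<and>
      card (inversions r) = card (inversions (r \<smallsetminus> ?e)) + length bs"
    if r: "r \<in> perms (Suc n)" for r
  proof -
    have "?e \<in> set r" using permsD(1)[OF r] by simp
    then obtain as bs where s: "r = as @ ?e # bs" "remove1 ?e r = as @ bs"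
        "set as \<union> set bs = {1..Suc n} - {?e}"
      using split_at_value[OF r] by metis
    then have "x < ?e" if "x \<in> set as \<union> set bs" for x
      using that by auto
    then have "filter (\<lambda>a. a > ?e) as = []" "filter (\<lambda>b. b < ?e) bs = bs"
      by (fastforce simp: filter_empty_conv filter_id_conv)+
    then show ?thesis
      using s card_inversions_insert[of as ?e bs] by (auto simp: card_inversions_del_value)
  qed
  obtain as bs cs ds where p: "p = as @ ?e # bs" "remove1 ?e p = as @ bs"
      "card (inversions p) = card (inversions (p \<smallsetminus> ?e)) + length bs"
    and q: "q = cs @ ?e # ds" "remove1 ?e q = cs @ ds"
      "card (inversions q) = card (inversions (q \<smallsetminus> ?e)) + length ds"
    using lost pq by metis
  have del: "p \<smallsetminus> ?e = q \<smallsetminus> ?e" using pq Max_perms by metis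
  then have "as @ bs = cs @ ds" using del_value_inj[OF pq(1,2)] p q by metis
  moreover have "length bs = length ds" using p(3) q(3) inv del by simp
  \<comment> \<open>Equal concatenations with right parts of equal length split at the same
    place.\<close>
  ultimately show "p = q" using p(1) q(1) by simp
qed auto

text \<open>Mirror case: the value 1 is inverted with exactly the entries to its left, so the loss
  is its position.\<close>

interpretation smallest: selector "\<lambda>xs. Min (set xs)"
proof
  fix xs :: "nat list" and f :: "nat \<Rightarrow> nat"
  assume *: "xs \<noteq> []" "strict_mono_on (set xs) f"
  then have "Min (f ` set xs) = f (Min (set xs))"
    by (intro Min_eqI) (auto intro: monotone_onD[OF strict_mono_on_imp_mono_on])
  then show "Min (set (map f xs)) = f (Min (set xs))" by simp
next
  fix xs :: "nat list" and P assume "xs \<noteq> []" "P (Min (set xs))"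
  then show "Min (set (filter P xs)) = Min (set xs)" by (intro Min_eqI) auto
next
  fix n p q
  assume pq: "p \<in> perms (Suc n)" "q \<in> perms (Suc n)"
    "p \<smallsetminus> Min (set p) = q \<smallsetminus> Min (set q)"
    and inv: "card (inversions p) = card (inversions q)"
  have lost: "\<exists>as bs. r = as @ 1 # bs \<and> remove1 1 r = as @ bs \<and>
      card (inversions r) = card (inversions (r \<smallsetminus> 1)) + length as"
    if r: "r \<in> perms (Suc n)" for r
  proof -
    have "1 \<in> set r" using permsD(1)[OF r] by simp
    then obtain as bs where s: "r = as @ 1 # bs" "remove1 1 r = as @ bs"
        "set as \<union> set bs = {1..Suc n} - {1}"
      using split_at_value[OF r] by metis
    then have "x > 1" if "x \<in> set as \<union> set bs" for x
      using that by auto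
    then have "filter (\<lambda>a. a > 1) as = as" "filter (\<lambda>b. b < 1) bs = []"
      by (fastforce simp: filter_empty_conv filter_id_conv)+
    then show ?thesis
      using s card_inversions_insert[of as 1 bs] by (auto simp: card_inversions_del_value)
  qed
  obtain as bs cs ds where p: "p = as @ 1 # bs" "remove1 1 p = as @ bs"
      "card (inversions p) = card (inversions (p \<smallsetminus> 1)) + length as"
    and q: "q = cs @ 1 # ds" "remove1 1 q = cs @ ds"
      "card (inversions q) = card (inversions (q \<smallsetminus> 1)) + length cs"
    using lost pq by metis
  have del: "p \<smallsetminus> 1 = q \<smallsetminus> 1" using pq Min_perms by metis
  then have "as @ bs = cs @ ds" using del_value_inj[OF pq(1,2)] p q by metis
  moreover have "length as = length cs" using p(3) q(3) inv del by simp
  ultimately show "p = q" using p(1) q(1) by simp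
qed auto

section \<open>The four extended collections\<close>

theorem proposition4p1:
  fixes B :: "nat list set"
  assumes "B \<subseteq> patterns"
    and "inversion_monotone B"
  shows "inversion_monotone {p \<in> patterns. p \<smallsetminus> hd p \<in> B} \<and>
         inversion_monotone {p \<in> patterns. p \<smallsetminus> last p \<in> B} \<and>
         inversion_monotone {p \<in> patterns. p \<smallsetminus> length p \<in> B} \<and>
         inversion_monotone {p \<in> patterns. p \<smallsetminus> 1 \<in> B}"
proof -
  \<comment> \<open>On patterns the values \<open>length p\<close> and 1 are the maximum and the
    minimum, which are defined for arbitrary lists and commute with standardization as the locale
    demands.\<close>
  have "Max (set p) = length p \<and> Min (set p) = 1" if "p \<in> patterns" for p
  proof -
    from that obtain m where "m \<ge> 1" "p \<in> perms m" by (auto simp: patterns_def)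
    then obtain n where "p \<in> perms (Suc n)" by (cases m) auto
    then show ?thesis using Max_perms Min_perms permsD(3) by simp
  qed
  then have "{p \<in> patterns. p \<smallsetminus> length p \<in> B} = largest.extension B"
      "{p \<in> patterns. p \<smallsetminus> 1 \<in> B} = smallest.extension B"
    unfolding largest.extension_def smallest.extension_def by auto
  then show ?thesis
    using first.inversion_monotone_extension[OF assms] final.inversion_monotone_extension[OF assms]
      largest.inversion_monotone_extension[OF assms] smallest.inversion_monotone_extension[OF assms]
    by (simp add: first.extension_def final.extension_def)
qed

end
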